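(* Consider Algorithm FoBa-obj with parameter $\delta$. Let $s$ be a positive integer such that $$(s-\bar k)>(\bar k+1)\left[\left(\sqrt{\frac{\rho_+(s)}{\rho_-(s)}}+1\right)\frac{2\rho_+(1)}{\rho_-(s)}\right]^2,$$ and take $\delta>\frac{4\rho_+(1)}{\rho_-(s)^2}\|\nabla Q(\bar\beta)\|_\infty^2$. Then the algorithm terminates at some $k\le s-\bar k$.
   Context: Let $Q:\mathbb{R}^d\to\mathbb{R}$ be convex and continuously differentiable. $e_j$ is the $j$-th standard basis vector, $\mathrm{supp}(\beta)=\{j:\beta_j\ne0\}$, $\|\beta\|_0=|\mathrm{supp}(\beta)|$, $\|\cdot\|$ is the Euclidean norm, $A-B$ is set difference, and $v_S$ is $v$ restricted to the coordinates in $S$. For $F\subseteq\{1,\dots,d\}$, $\hat\beta(F)$ denotes a minimizer of $Q$ over $\{\beta:\mathrm{supp}(\beta)\subseteq F\}$ (assumed to exist). For a positive integer $s$, the restricted strong convexity constants $\rho_-(s),\rho_+(s)>0$ are constants such that for all $\beta,\beta'\in\mathbb{R}^d$ with $\|\beta'-\beta\|_0\le s$: $\frac{\rho_-(s)}{2}\|\beta'-\beta\|^2\le Q(\beta')-Q(\beta)-\langle\nabla Q(\beta),\beta'-\beta\rangle\le\frac{\rho_+(s)}{2}\|\beta'-\beta\|^2.$ $\bar\beta$ is a solution of $\min_\beta Q(\beta)$ subject to $\|\beta\|_0\le\bar k$, $\bar F=\mathrm{supp}(\bar\beta)$ and $\bar k=|\bar F|$. Algorithm FoBa has two variants: FoBa-obj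 (parameter $\delta>0$) and FoBa-gdt (parameter $\epsilon>0$). Initialize $F^{(0)}=\emptyset$, $\beta^{(0)}=0$, $k=0$, and repeat the following iteration. (1) Stopping test: FoBa-obj stops if $Q(\beta^{(k)})-\min_{\alpha\in\mathbb{R},\,j\notin F^{(k)}}Q(\beta^{(k)}+\alpha e_j)<\delta$; FoBa-gdt stops if $\|\nabla Q(\beta^{(k)})\|_\infty<\epsilon$. On stopping the output is $\beta^{(k)}$ with support $F^{(k)}$, and the algorithm is said to terminate at $k$. (2) Forward step: FoBa-obj picks $i^{(k)}\in\arg\min_{i\notin F^{(k)}}\min_\alpha Q(\beta^{(k)}+\alpha e_i)$; FoBa-gdt picks $i^{(k)}\in\arg\max_{i\notin F^{(k)}}|\nabla Q(\beta^{(k)})_i|$. Set $F^{(k+1)}=F^{(k)}\cup\{i^{(k)}\}$, $\beta^{(k+1)}=\hat\beta(F^{(k+1)})$, $\delta^{(k+1)}=Q(\beta^{(k)})-Q(\beta^{(k+1)})$, $k\leftarrow k+1$. (3) Backward step: repeat — if $F^{(k)}=\emptyset$ or $\min_{i\in F^{(k)}}Q(\beta^{(k)}-\beta^{(k)}_ie_i)-Q(\beta^{(k)})\ge\delta^{(k)}/2$, leave the backward step; otherwise pick $j\in\arg\min_{i\in F^{(k)}}Q(\beta^{(k)}-\beta^{(k)}_ie_i)$, set $F^{(k-1)}=F^{(k)}-\{j\}$, $\beta^{(k-1)}=\hat\beta(F^{(k-1)})$, $k\leftarrow k-1$ (where $\delta^{(k-1)}$ is the value recorded at the most recent forward step producing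 index $k-1$). Thus $|F^{(k)}|=k$ always. "At the beginning of an iteration" means the state just before a stopping test. *)

theory Defs
  imports "HOL-Analysis.Analysis"
begin

text \<open>Vectors in R^d are modelled as real^'n for a finite index type 'n (d = CARD('n)).
  A state of FoBa at the beginning of an iteration is (F, beta, D) where F = F^(k),
  beta = beta^(k), k = card F, and D j is the value delta^(j) recorded at the most
  recent forward step producing index j.\<close>

definition supp :: "real^'n \<Rightarrow> 'n set" where
  "supp b = {j. b $ j \<noteq> 0}"

definition l0norm :: "real^'n \<Rightarrow> nat" where
  "l0norm b = card (supp b)"

definition linf :: "real^'n \<Rightarrow> real" where
  "linf v = (MAX j\<in>UNIV. \<bar>v $ j\<bar>)"

definition restr_min :: "(real^'n \<Rightarrow> real) \<Rightarrow> 'n set \<Rightarrow> real^'n \<Rightarrow> bool" where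
  "restr_min Q F b \<longleftrightarrow> supp b \<subseteq> F \<and> (\<forall>b'. supp b' \<subseteq> F \<longrightarrow> Q b \<le> Q b')"

definition rsc :: "(real^'n \<Rightarrow> real) \<Rightarrow> (real^'n \<Rightarrow> real^'n) \<Rightarrow> nat \<Rightarrow> real \<Rightarrow> real \<Rightarrow> bool" where
  "rsc Q grad s rm rp \<longleftrightarrow> rm > 0 \<and> rp > 0 \<and>
     (\<forall>b b'. l0norm (b' - b) \<le> s \<longrightarrow>
        rm / 2 * (norm (b' - b))\<^sup>2 \<le> Q b' - Q b - grad b \<bullet> (b' - b) \<and>
        Q b' - Q b - grad b \<bullet> (b' - b) \<le> rp / 2 * (norm (b' - b))\<^sup>2)"

definition line_min :: "(real^'n \<Rightarrow> real) \<Rightarrow> real^'n \<Rightarrow> 'n \<Rightarrow> real" where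
  "line_min Q b j = (INF \<alpha>::real. Q (b + \<alpha> *\<^sub>R axis j 1))"

definition zero_at :: "real^'n \<Rightarrow> 'n \<Rightarrow> real^'n" where
  "zero_at b i = b - (b $ i) *\<^sub>R axis i 1"

type_synonym 'n foba_state = "'n set \<times> (real^'n) \<times> (nat \<Rightarrow> real)"

text \<open>Stopping test of FoBa-obj; a minimum over the empty set (F = all coordinates)
  is +infinity, so the test succeeds in that case.\<close>
definition obj_stop :: "(real^'n \<Rightarrow> real) \<Rightarrow> real \<Rightarrow> 'n foba_state \<Rightarrow> bool" where
  "obj_stop Q \<delta> = (\<lambda>(F, b, D). F = UNIV \<or> Q b - (INF j\<in>- F. line_min Q b j) < \<delta>)"

definition fwd :: "(real^'n \<Rightarrow> real) \<Rightarrow> 'n foba_state \<Rightarrow> 'n foba_state \<Rightarrow> bool" where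
  "fwd Q = (\<lambda>(F, b, D) (F', b', D').
     \<exists>i. i \<notin> F \<and> (\<forall>i'. i' \<notin> F \<longrightarrow> line_min Q b i \<le> line_min Q b i') \<and>
         F' = insert i F \<and> restr_min Q F' b' \<and> D' = D(card F' := Q b - Q b'))"

definition bwd_cont :: "(real^'n \<Rightarrow> real) \<Rightarrow> 'n foba_state \<Rightarrow> bool" where
  "bwd_cont Q = (\<lambda>(F, b, D). F \<noteq> {} \<and>
     (MIN i\<in>F. Q (zero_at b i)) - Q b < D (card F) / 2)"

definition bwd :: "(real^'n \<Rightarrow> real) \<Rightarrow> 'n foba_state \<Rightarrow> 'n foba_state \<Rightarrow> bool" where
  "bwd Q st st' \<longleftrightarrow> bwd_cont Q st \<and> (case st of (F, b, D) \<Rightarrow> case st' of (F', b', D') \<Rightarrow>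
     \<exists>j\<in>F. (\<forall>i\<in>F. Q (zero_at b j) \<le> Q (zero_at b i)) \<and>
        F' = F - {j} \<and> restr_min Q F' b' \<and> D' = D)"

definition foba_iter :: "(real^'n \<Rightarrow> real) \<Rightarrow> real \<Rightarrow> 'n foba_state \<Rightarrow> 'n foba_state \<Rightarrow> bool" where
  "foba_iter Q \<delta> st st' \<longleftrightarrow> \<not> obj_stop Q \<delta> st \<and>
     (\<exists>st1. fwd Q st st1 \<and> (bwd Q)\<^sup>*\<^sup>* st1 st' \<and> \<not> bwd_cont Q st')"

definition foba_init :: "('n::finite) foba_state" where
  "foba_init = ({}, 0, \<lambda>_. 0)"

end

theory Submission
  imports Defs
begin

text \<open>
  Write \<open>F\<close>, \<open>\<beta>\<close> for the current support and iterate and \<open>k = card F\<close>.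

  Termination: the potential \<open>Q \<beta> + (\<Sum>j=1..k. D j / 2)\<close> is bounded below. A forward step lowers
  \<open>Q\<close> by \<open>D (k + 1) \<ge> \<delta>\<close>, hence the potential by at least \<open>\<delta> / 2\<close>; a backward step raises \<open>Q\<close> by less
  than \<open>D k / 2\<close>, hence lowers the potential.

  Size bound: \<open>k\<close> can only reach \<open>s - l0norm \<beta>bar\<close> through a forward step that is not followed by
  a backward step. Let \<open>\<beta>'\<close> minimise \<open>Q\<close> over \<open>F \<union> supp \<beta>bar\<close>. The failed backward test
  says that every coordinate of \<open>\<beta>\<close> is large, so that \<open>card (F - supp \<beta>bar) * D k\<close> is at most a multiple of
  \<open>\<parallel>\<beta> - \<beta>bar\<parallel>\<^sup>2\<close>; for \<open>\<delta>\<close> as large as assumed this also forces \<open>Q \<beta>bar \<le> Q \<beta>\<close>, hence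
  \<open>\<parallel>\<beta> - \<beta>bar\<parallel> \<le> (sqrt (\<rho>\<^sub>+ / \<rho>\<^sub>-) + 1) * \<parallel>\<beta> - \<beta>'\<parallel>\<close>. Greediness of the forward step bounds
  \<open>\<parallel>\<beta> - \<beta>'\<parallel>\<^sup>2\<close> by a multiple of \<open>D k\<close>. Cancelling \<open>D k > 0\<close> contradicts the choice of \<open>s\<close>.
\<close>

section \<open>Coordinates, supports and minimisers over a fixed support\<close>

lemma norm_vec_power2: "(norm (v :: real^'n))\<^sup>2 = (\<Sum>j\<in>UNIV. (v $ j)\<^sup>2)"
  unfolding power2_norm_eq_inner inner_vec_def by (simp add: power2_eq_square)

lemma abs_nth_le_linf: "\<bar>v $ j\<bar> \<le> linf (v :: real^'n)"
  unfolding linf_def by (rule Max_ge) auto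

lemma l0norm_le_card:
  assumes "supp (v :: real^'n) \<subseteq> A" shows "l0norm v \<le> card A"
  unfolding l0norm_def by (rule card_mono) (use assms in auto)

lemma supp_diff_subset: "supp (u - v) \<subseteq> supp u \<union> supp (v :: real^'n)"
  unfolding supp_def by auto

lemma supp_scaled_axis: "supp (c *\<^sub>R axis j 1 :: real^'n) \<subseteq> {j}"
  unfolding supp_def by (auto simp: axis_def)

lemma restr_min_supp: "restr_min Q F b \<Longrightarrow> j \<notin> F \<Longrightarrow> b $ j = 0"
  unfolding restr_min_def supp_def by auto

lemma restr_min_le: "restr_min Q F b \<Longrightarrow> supp b' \<subseteq> F \<Longrightarrow> Q b \<le> Q b'"
  unfolding restr_min_def by blast

lemma restr_min_mono:
  "restr_min Q F b \<Longrightarrow> restr_min Q G c \<Longrightarrow> F \<subseteq> G \<Longrightarrow> Q c \<le> Q b"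
  unfolding restr_min_def by blast

section \<open>Restricted strong convexity and the gradient at restricted minimisers\<close>

lemma rsc_lower:
  "rsc Q grad s m p \<Longrightarrow> l0norm (b' - b) \<le> s \<Longrightarrow>
    m / 2 * (norm (b' - b))\<^sup>2 \<le> Q b' - Q b - grad b \<bullet> (b' - b)"
  unfolding rsc_def by blast

lemma rsc_upper:
  "rsc Q grad s m p \<Longrightarrow> l0norm (b' - b) \<le> s \<Longrightarrow>
    Q b' - Q b - grad b \<bullet> (b' - b) \<le> p / 2 * (norm (b' - b))\<^sup>2"
  unfolding rsc_def by blast

lemma rsc_pos: "rsc Q grad s m p \<Longrightarrow> 0 < m" "rsc Q grad s m p \<Longrightarrow> 0 < p"
  unfolding rsc_def by auto

lemma rsc_axis_upper:
  fixes Q :: "real^'n \<Rightarrow> real"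
  assumes "rsc Q grad s m p" "1 \<le> s"
  shows "Q (b + c *\<^sub>R axis j 1) \<le> Q b + c * grad b $ j + p / 2 * c\<^sup>2"
proof -
  have "l0norm (b + c *\<^sub>R axis j 1 - b) \<le> s"
    using l0norm_le_card[OF supp_scaled_axis[of c j]] assms(2) by simp
  from rsc_upper[OF assms(1) this] show ?thesis
    by (simp add: inner_axis inner_commute norm_axis_1 power_mult_distrib)
qed

text \<open>Both inequalities are tested on one unit vector based at 0, whose support has size
  1.\<close>

lemma rsc_constants_le:
  fixes Q :: "real^'n \<Rightarrow> real"
  assumes "rsc Q grad s m p" "rsc Q grad t m' p'" "1 \<le> s" "1 \<le> t"
  shows "m \<le> p'"
proof -
  obtain j :: 'n where True by simp
  let ?e = "axis j 1 :: real^'n"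
  have "l0norm (?e - 0) \<le> 1"
    using l0norm_le_card[OF supp_scaled_axis[of 1 j]] by simp
  then have "l0norm (?e - 0) \<le> s" "l0norm (?e - 0) \<le> t" using assms(3,4) by linarith+
  from rsc_lower[OF assms(1) this(1)] rsc_upper[OF assms(2) this(2)]
  show ?thesis by (simp add: norm_axis_1)
qed

text \<open>The step \<open>- ?g / p\<close> minimises the quadratic upper bound along coordinate
  \<open>j\<close>. It keeps the support in \<open>F\<close> and would lower \<open>Q\<close> by at
  least \<open>?g\<^sup>2 / (2 * p)\<close>, so minimality forces \<open>?g = 0\<close>.\<close>

lemma restr_min_grad_zero:
  fixes Q :: "real^'n \<Rightarrow> real"
  assumes r: "rsc Q grad s m p" and s: "1 \<le> s" and min: "restr_min Q F b" and j: "j \<in> F"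
  shows "grad b $ j = 0"
proof -
  let ?g = "grad b $ j"
  have p: "0 < p" using rsc_pos[OF r] by simp
  have "supp (b + (- ?g / p) *\<^sub>R axis j 1) \<subseteq> F"
    using restr_min_supp[OF min] j unfolding supp_def by (auto simp: axis_def)
  from restr_min_le[OF min this] rsc_axis_upper[OF r s, of b "- ?g / p" j]
  have "0 \<le> (- ?g / p) * ?g + p / 2 * (- ?g / p)\<^sup>2" by linarith
  also have "\<dots> = - (?g\<^sup>2 / (2 * p))"
    using p by (simp add: field_simps power2_eq_square)
  finally have "?g\<^sup>2 / (2 * p) \<le> 0" by simp
  then have "?g\<^sup>2 \<le> 0" using p by (simp add: divide_le_0_iff)
  then show ?thesis by simp
qed

section \<open>Estimates around restricted minimisers\<close>

text \<open>On \<open>F\<close> the factor \<open>g\<close> vanishes, outside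
  \<open>F \<union> G\<close> both vectors vanish, and on \<open>G - F\<close> only \<open>u\<close>
  is left. In use, \<open>b\<close> is a minimiser over \<open>F\<close> and \<open>g\<close> its
  gradient.\<close>

lemma inner_grad_diff:
  fixes g u b :: "real^'n"
  assumes "\<And>j. j \<in> F \<Longrightarrow> g $ j = 0" "supp b \<subseteq> F" "supp u \<subseteq> G"
  shows "g \<bullet> (u - b) = (\<Sum>j\<in>G - F. g $ j * u $ j)"
proof -
  have "g \<bullet> (u - b) = (\<Sum>j\<in>UNIV. g $ j * (u $ j - b $ j))"
    by (simp add: inner_vec_def)
  also have "\<dots> = (\<Sum>j\<in>G - F. g $ j * (u $ j - b $ j))"
    using assms unfolding supp_def by (intro sum.mono_neutral_right) force+
  also have "\<dots> = (\<Sum>j\<in>G - F. g $ j * u $ j)"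
    using assms(2) unfolding supp_def by (intro sum.cong) auto
  finally show ?thesis .
qed

lemma sum_power2_le_norm_diff:
  fixes u b :: "real^'n"
  assumes "supp b \<subseteq> F"
  shows "(\<Sum>j\<in>G - F. (u $ j)\<^sup>2) \<le> (norm (u - b))\<^sup>2"
proof -
  have "(\<Sum>j\<in>G - F. (u $ j)\<^sup>2) = (\<Sum>j\<in>G - F. ((u - b) $ j)\<^sup>2)"
    using assms unfolding supp_def by (intro sum.cong) force+
  also have "\<dots> \<le> (norm (u - b))\<^sup>2"
    unfolding norm_vec_power2 by (intro sum_mono2) auto
  finally show ?thesis .
qed

text \<open>The gain of the best single coordinate is at least the average gain over \<open>G - F\<close> of the steps
  \<open>(m / p) * u $ j\<close>, where \<open>m / p\<close> is the factor for which the quadratic terms cancel.\<close>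

lemma greedy_gain:
  fixes Q :: "real^'n \<Rightarrow> real"
  assumes r: "rsc Q grad s m p'" and r1: "rsc Q grad 1 m' p"
    and s: "1 \<le> s" and min: "restr_min Q F b"
    and u: "supp u \<subseteq> G" and FG: "F \<subseteq> G" and G: "card G \<le> s"
    and gain: "\<And>j c. j \<in> G - F \<Longrightarrow> Q b - Q (b + c *\<^sub>R axis j 1) \<le> d"
  shows "m / p * (Q b - Q u) \<le> real (card (G - F)) * d"
proof -
  have m: "0 < m" and p: "0 < p" using rsc_pos[OF r] rsc_pos[OF r1] by auto
  let ?g = "grad b"
  define e where "e = m / p"
  have e: "0 < e" and pe: "p * e = m" using m p unfolding e_def by simp_all
  have sb: "supp b \<subseteq> F" using min unfolding restr_min_def by simp
  have "l0norm (u - b) \<le> s"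
    using l0norm_le_card[of "u - b" G] supp_diff_subset[of u b] sb u FG G by fastforce
  from rsc_lower[OF r this]
  have low: "m / 2 * (norm (u - b))\<^sup>2 \<le> Q u - Q b - ?g \<bullet> (u - b)" .
  have inn: "?g \<bullet> (u - b) = (\<Sum>j\<in>G - F. ?g $ j * u $ j)"
    using restr_min_grad_zero[OF r s min] sb u by (intro inner_grad_diff) auto
  have "(\<Sum>j\<in>G - F. - e * (?g $ j * u $ j) - p / 2 * e\<^sup>2 * (u $ j)\<^sup>2) \<le> (\<Sum>j\<in>G - F. d)"
  proof (rule sum_mono)
    fix j assume "j \<in> G - F"
    from gain[OF this, of "e * u $ j"] rsc_axis_upper[OF r1 order_refl, of b "e * u $ j" j]
    show "- e * (?g $ j * u $ j) - p / 2 * e\<^sup>2 * (u $ j)\<^sup>2 \<le> d"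
      by (simp add: power_mult_distrib mult_ac)
  qed
  then have "- e * (?g \<bullet> (u - b)) - p / 2 * e\<^sup>2 * (\<Sum>j\<in>G - F. (u $ j)\<^sup>2)
      \<le> real (card (G - F)) * d"
    by (simp only: inn sum_subtractf sum_distrib_left sum_constant)
  moreover have "p / 2 * e\<^sup>2 * (\<Sum>j\<in>G - F. (u $ j)\<^sup>2) \<le> p / 2 * e\<^sup>2 * (norm (u - b))\<^sup>2"
    using p by (intro mult_left_mono sum_power2_le_norm_diff sb) auto
  moreover have "p / 2 * e\<^sup>2 * (norm (u - b))\<^sup>2 = e * (m / 2 * (norm (u - b))\<^sup>2)"
    unfolding pe[symmetric] by (simp add: power2_eq_square)
  moreover have "e * (m / 2 * (norm (u - b))\<^sup>2) \<le> e * (Q u - Q b - ?g \<bullet> (u - b))"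
    using low e by (intro mult_left_mono) auto
  ultimately show ?thesis unfolding e_def[symmetric] right_diff_distrib by linarith
qed

text \<open>As the gradient vanishes on \<open>F\<close>, zeroing coordinate \<open>i\<close> raises
  \<open>Q\<close> by at most \<open>p / 2 * (b $ i)\<^sup>2\<close>, while the failed test makes
  the rise at least \<open>D (card F) / 2\<close>. Summing over \<open>F - G\<close>, where
  \<open>v\<close> vanishes, brings in the distance.\<close>

lemma backward_exit_bound:
  fixes Q :: "real^'n \<Rightarrow> real"
  assumes r1: "rsc Q grad 1 m p" and min: "restr_min Q F b" and ex: "\<not> bwd_cont Q (F, b, D)"
    and v: "supp v \<subseteq> G"
  shows "real (card (F - G)) * D (card F) \<le> p * (norm (b - v))\<^sup>2"
proof -
  have p: "0 < p" using rsc_pos[OF r1] by simp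
  have each: "D (card F) \<le> p * (b $ i)\<^sup>2" if i: "i \<in> F" for i
  proof -
    have "F \<noteq> {}" using i by auto
    then have "D (card F) / 2 \<le> (MIN i\<in>F. Q (zero_at b i)) - Q b"
      using ex unfolding bwd_cont_def by simp
    also have "(MIN i\<in>F. Q (zero_at b i)) \<le> Q (zero_at b i)"
      using i by (intro Min_le) auto
    also have "Q (zero_at b i) \<le> Q b + p / 2 * (b $ i)\<^sup>2"
      using rsc_axis_upper[OF r1 order_refl, of b "- (b $ i)" i]
        restr_min_grad_zero[OF r1 order_refl min i]
      by (simp add: zero_at_def)
    finally show ?thesis by simp
  qed
  have "real (card (F - G)) * D (card F) \<le> (\<Sum>i\<in>F - G. p * (b $ i)\<^sup>2)"
    using sum_mono[of "F - G" "\<lambda>_. D (card F)"] each by simp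
  also have "\<dots> = p * (\<Sum>i\<in>F - G. (b $ i)\<^sup>2)" by (simp add: sum_distrib_left)
  also have "\<dots> \<le> p * (norm (b - v))\<^sup>2"
    using p by (intro mult_left_mono sum_power2_le_norm_diff v) auto
  finally show ?thesis .
qed

text \<open>Strong convexity gives \<open>Q b - Q v \<ge> m / 2 * N - L * S\<close>. Cauchy-Schwarz
  yields \<open>S\<^sup>2 \<le> c * N\<close>, and the assumptions on \<open>d\<close> yield
  \<open>4 * L\<^sup>2 * c \<le> m\<^sup>2 * N\<close>; together
  \<open>2 * L * S \<le> m * N\<close>, so the linear term cannot win.\<close>

lemma sparse_minimum_le:
  fixes Q :: "real^'n \<Rightarrow> real"
  assumes r: "rsc Q grad s m p'" and s: "1 \<le> s" and p: "0 < p"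
    and min: "restr_min Q G v" and b: "supp b \<subseteq> F" and FG: "card (F \<union> G) \<le> s"
    and d: "4 * p / m\<^sup>2 * (linf (grad v))\<^sup>2 \<le> d"
    and size: "real (card (F - G)) * d \<le> p * (norm (b - v))\<^sup>2"
  shows "Q v \<le> Q b"
proof -
  have m: "0 < m" using rsc_pos[OF r] by simp
  define L where "L = linf (grad v)"
  define c where "c = real (card (F - G))"
  define S where "S = (\<Sum>j\<in>F - G. \<bar>b $ j\<bar>)"
  define N where "N = (norm (b - v))\<^sup>2"
  have L0: "0 \<le> L" using abs_nth_le_linf[of "grad v" undefined] unfolding L_def by linarith
  have N0: "0 \<le> N" unfolding N_def by simp
  have sv: "supp v \<subseteq> G" using min unfolding restr_min_def by simp
  have "l0norm (b - v) \<le> s"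
    using l0norm_le_card[of "b - v" "F \<union> G"] supp_diff_subset[of b v] sv b FG by fastforce
  from rsc_lower[OF r this]
  have low: "m / 2 * N \<le> Q b - Q v - grad v \<bullet> (b - v)" unfolding N_def .
  have "grad v \<bullet> (b - v) = (\<Sum>j\<in>F - G. grad v $ j * b $ j)"
    using restr_min_grad_zero[OF r s min] sv b by (intro inner_grad_diff) auto
  moreover have "(\<Sum>j\<in>F - G. - (L * \<bar>b $ j\<bar>)) \<le> (\<Sum>j\<in>F - G. grad v $ j * b $ j)"
  proof (rule sum_mono)
    fix j
    have "\<bar>grad v $ j * b $ j\<bar> \<le> L * \<bar>b $ j\<bar>"
      unfolding abs_mult L_def by (intro mult_right_mono abs_nth_le_linf) auto
    then show "- (L * \<bar>b $ j\<bar>) \<le> grad v $ j * b $ j" by linarith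
  qed
  ultimately have inn: "- (L * S) \<le> grad v \<bullet> (b - v)"
    by (simp add: S_def sum_negf sum_distrib_left)
  have "S\<^sup>2 \<le> c * (\<Sum>j\<in>F - G. (b $ j)\<^sup>2)"
    using sum_squared_le_sum_of_squares[of "\<lambda>j. \<bar>b $ j\<bar>" "F - G"]
    unfolding S_def c_def by (simp add: mult.commute)
  also have "\<dots> \<le> c * N"
    unfolding c_def N_def by (intro mult_left_mono sum_power2_le_norm_diff sv) auto
  finally have S: "S\<^sup>2 \<le> c * N" .
  have "c * (4 * p / m\<^sup>2 * L\<^sup>2) \<le> c * d"
    using d unfolding c_def L_def by (intro mult_left_mono) auto
  also have "\<dots> \<le> p * N" using size unfolding c_def N_def .
  finally have "p * (4 * L\<^sup>2 * c) \<le> p * (m\<^sup>2 * N)" using m by (simp add: field_simps)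
  then have cL: "4 * L\<^sup>2 * c \<le> m\<^sup>2 * N" using p by simp
  have "(2 * L * S)\<^sup>2 = 4 * L\<^sup>2 * S\<^sup>2" by (simp add: power_mult_distrib)
  also have "\<dots> \<le> 4 * L\<^sup>2 * (c * N)" using S by (intro mult_left_mono) auto
  also have "\<dots> = (4 * L\<^sup>2 * c) * N" by simp
  also have "\<dots> \<le> (m\<^sup>2 * N) * N" using cL N0 by (rule mult_right_mono)
  also have "\<dots> = (m * N)\<^sup>2" by (simp add: power2_eq_square)
  finally have "2 * L * S \<le> m * N"
    by (rule power2_le_imp_le) (use m N0 in auto)
  then show ?thesis using low inn by linarith
qed

text \<open>The gradient at \<open>u\<close> is orthogonal to all differences inside
  \<open>H\<close>, so \<open>Q x - Q u\<close> is comparable to the squared distance from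
  \<open>u\<close>. Hence \<open>Q v \<le> Q b\<close> bounds the distance of \<open>v\<close> from
  \<open>u\<close> by that of \<open>b\<close>, up to \<open>sqrt (p / m)\<close>; the triangle
  inequality adds the 1.\<close>

lemma norm_diff_le_via_minimum:
  fixes Q :: "real^'n \<Rightarrow> real"
  assumes r: "rsc Q grad s m p" and s: "1 \<le> s" and H: "card H \<le> s"
    and min: "restr_min Q H u" and b: "supp b \<subseteq> H" and v: "supp v \<subseteq> H" and le: "Q v \<le> Q b"
  shows "norm (b - v) \<le> (sqrt (p / m) + 1) * norm (b - u)"
proof -
  have m: "0 < m" and p: "0 < p" using rsc_pos[OF r] by auto
  have u: "supp u \<subseteq> H" using min unfolding restr_min_def by simp
  have g: "grad u \<bullet> (x - u) = 0" if "supp x \<subseteq> H" for x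
    using inner_grad_diff[OF restr_min_grad_zero[OF r s min] u that] by simp
  have l: "l0norm (x - u) \<le> s" if "supp x \<subseteq> H" for x
    using l0norm_le_card[of "x - u" H] supp_diff_subset[of x u] u that H by fastforce
  have "m / 2 * (norm (v - u))\<^sup>2 \<le> p / 2 * (norm (b - u))\<^sup>2"
    using rsc_lower[OF r l[OF v]] rsc_upper[OF r l[OF b]] g[OF v] g[OF b] le by linarith
  then have "(norm (v - u))\<^sup>2 \<le> p / m * (norm (b - u))\<^sup>2"
    using m by (simp add: field_simps)
  then have "norm (v - u) \<le> sqrt (p / m * (norm (b - u))\<^sup>2)"
    by (rule real_le_rsqrt)
  also have "\<dots> = sqrt (p / m) * norm (b - u)"
    by (simp only: real_sqrt_mult real_sqrt_abs abs_norm_cancel)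
  finally have "norm (v - u) \<le> sqrt (p / m) * norm (b - u)" .
  moreover have "norm (b - v) \<le> norm (b - u) + norm (v - u)"
    using norm_triangle_ineq4[of "b - u" "v - u"] by simp
  ultimately show ?thesis by (simp add: algebra_simps)
qed

section \<open>The forward step\<close>

text \<open>The refit over \<open>insert i F\<close> competes with every step along
  \<open>i\<close>, and greediness passes this on to the other coordinates. The bound
  \<open>lb\<close> makes the real-valued \<open>INF\<close> in \<open>line_min\<close> a true
  infimum.\<close>

lemma forward_le_line:
  fixes Q :: "real^'n \<Rightarrow> real"
  assumes bdd: "\<And>x. lb \<le> Q x" and supp: "supp b \<subseteq> F"
    and i: "\<And>i'. i' \<notin> F \<Longrightarrow> line_min Q b i \<le> line_min Q b i'"
    and min: "restr_min Q (insert i F) b'"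
  shows "j \<notin> F \<Longrightarrow> Q b' \<le> line_min Q b j"
    and "j \<notin> F \<Longrightarrow> Q b' \<le> Q (b + c *\<^sub>R axis j 1)"
proof -
  have "Q b' \<le> Q (b + c *\<^sub>R axis i 1)" for c
    using supp by (intro restr_min_le[OF min]) (auto simp: supp_def axis_def split: if_splits)
  then have "Q b' \<le> line_min Q b i"
    unfolding line_min_def by (intro cINF_greatest) auto
  then show *: "Q b' \<le> line_min Q b j" if "j \<notin> F" for j using i[OF that] by linarith
  have "line_min Q b j \<le> Q (b + c *\<^sub>R axis j 1)"
    unfolding line_min_def by (rule cINF_lower) (auto intro!: bdd_belowI[of _ lb] bdd)
  then show "j \<notin> F \<Longrightarrow> Q b' \<le> Q (b + c *\<^sub>R axis j 1)" using * by force
qed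

lemma forward_gain_ge:
  fixes Q :: "real^'n \<Rightarrow> real"
  assumes "\<And>x. lb \<le> Q x" "restr_min Q F b" "fwd Q (F, b, D) (F', b', D')"
    and "\<not> obj_stop Q \<delta> (F, b, D)"
  shows "\<delta> \<le> Q b - Q b'"
proof -
  obtain i where i: "\<And>i'. i' \<notin> F \<Longrightarrow> line_min Q b i \<le> line_min Q b i'"
    "restr_min Q (insert i F) b'"
    using assms(3) unfolding fwd_def by auto
  have "- F \<noteq> {}" and stop: "\<delta> \<le> Q b - (INF j\<in>- F. line_min Q b j)"
    using assms(4) unfolding obj_stop_def by auto
  moreover have "supp b \<subseteq> F" using assms(2) unfolding restr_min_def by simp
  ultimately have "Q b' \<le> (INF j\<in>- F. line_min Q b j)"
    using forward_le_line(1)[OF assms(1) _ i] by (intro cINF_greatest) auto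
  then show ?thesis using stop by linarith
qed

section \<open>Invariant, potential and termination\<close>

text \<open>Nonnegativity of every \<open>D j\<close>, the initial zeros included, keeps the sum in
  the potential nonnegative.\<close>

definition foba_inv :: "(real^'n \<Rightarrow> real) \<Rightarrow> 'n foba_state \<Rightarrow> bool" where
  "foba_inv Q = (\<lambda>(F, b, D). restr_min Q F b \<and> (\<forall>j. 0 \<le> D j))"

text \<open>Each level holds in reserve half the gain of the forward step that last produced it,
  which covers the cost of a backward step from that level.\<close>

definition foba_pot :: "(real^'n \<Rightarrow> real) \<Rightarrow> 'n foba_state \<Rightarrow> real" where
  "foba_pot Q = (\<lambda>(F, b, D). Q b + (\<Sum>j=1..card F. D j / 2))"

lemma foba_inv_init: "foba_inv Q foba_init"
  unfolding foba_inv_def foba_init_def restr_min_def supp_def 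
  by (auto simp: vec_eq_iff intro!: eq_refl arg_cong[where f = Q])

lemma card_forward:
  fixes F F' :: "'n::finite set"
  shows "fwd Q (F, b, D) (F', b', D') \<Longrightarrow> card F' = Suc (card F)"
  unfolding fwd_def by auto

lemma foba_inv_forward:
  assumes "foba_inv Q st" "fwd Q st st'" shows "foba_inv Q st'"
proof -
  obtain F b D F' b' D' where st: "st = (F, b, D)" "st' = (F', b', D')"
    by (cases st, cases st') auto
  have "Q b' \<le> Q b" "restr_min Q F' b'" "D' = D(card F' := Q b - Q b')"
    using assms restr_min_mono[of Q F b F' b'] unfolding st foba_inv_def fwd_def by auto
  then show ?thesis using assms(1) unfolding st foba_inv_def by auto
qed

text \<open>Only the entry at the new level is overwritten: \<open>Q\<close> falls by the full gain,
  the sum takes back half of it, and the gain is at least \<open>\<delta>\<close>.\<close>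

lemma foba_pot_forward:
  fixes Q :: "real^'n \<Rightarrow> real"
  assumes "\<And>x. lb \<le> Q x" "foba_inv Q st" "fwd Q st st'" "\<not> obj_stop Q \<delta> st"
  shows "foba_pot Q st' \<le> foba_pot Q st - \<delta> / 2"
proof -
  obtain F b D F' b' D' where st: "st = (F, b, D)" "st' = (F', b', D')"
    by (cases st, cases st') auto
  have card: "card F' = Suc (card F)" using card_forward assms(3) unfolding st by metis
  have "D' = D(card F' := Q b - Q b')" using assms(3) unfolding st fwd_def by auto
  then have D': "D' = D(Suc (card F) := Q b - Q b')" unfolding card .
  have "(\<Sum>j=1..card F. D' j / 2) = (\<Sum>j=1..card F. D j / 2)"
    unfolding D' by (intro sum.cong) auto
  moreover have "\<delta> \<le> Q b - Q b'"
    using assms(2) unfolding st foba_inv_def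
    by (intro forward_gain_ge[OF assms(1) _ assms(3,4)[unfolded st]]) simp
  ultimately show ?thesis
    unfolding st foba_pot_def by (simp add: card D' field_simps)
qed

lemma foba_inv_backward:
  assumes "foba_inv Q st" "bwd Q st st'" shows "foba_inv Q st'"
  using assms unfolding foba_inv_def bwd_def by auto

lemma backward_card:
  fixes st :: "'n::finite foba_state"
  shows "bwd Q st st' \<Longrightarrow> Suc (card (fst st')) = card (fst st)"
  unfolding bwd_def by (auto simp: card_Suc_Diff1 simp del: card_Diff_singleton card_Diff_insert)

text \<open>Refitting is at least as good as zeroing \<open>j\<close>, which costs less than
  \<open>D (card F) / 2\<close>, precisely the summand that leaves the sum.\<close>

lemma foba_pot_backward:
  fixes Q :: "real^'n \<Rightarrow> real"
  assumes "foba_inv Q st" "bwd Q st st'"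
  shows "foba_pot Q st' \<le> foba_pot Q st"
proof -
  obtain F b D F' b' D' where st: "st = (F, b, D)" "st' = (F', b', D')"
    by (cases st, cases st') auto
  obtain j where j: "j \<in> F" "\<And>i. i \<in> F \<Longrightarrow> Q (zero_at b j) \<le> Q (zero_at b i)"
    and F': "F' = F - {j}" "restr_min Q F' b'" "D' = D"
    and c: "(MIN i\<in>F. Q (zero_at b i)) - Q b < D (card F) / 2"
    using assms(2) unfolding st bwd_def bwd_cont_def by auto
  have "(MIN i\<in>F. Q (zero_at b i)) = Q (zero_at b j)"
    using j by (intro Min_eqI) auto
  moreover have "Q b' \<le> Q (zero_at b j)"
    using assms(1) unfolding st foba_inv_def
    by (intro restr_min_le[OF F'(2)])
      (auto simp: F'(1) zero_at_def supp_def axis_def restr_min_def split: if_splits)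
  moreover have "card F = Suc (card F')" using backward_card[OF assms(2)] st by simp
  ultimately show ?thesis using c F'(3) unfolding st foba_pot_def by simp
qed

text \<open>The last conjunct separates the case of no backward step from that of a shrunken
  support, as the size bound requires.\<close>

lemma backward_rtranclp:
  fixes Q :: "real^'n \<Rightarrow> real"
  assumes "(bwd Q)\<^sup>*\<^sup>* st st'" "foba_inv Q st"
  shows "foba_inv Q st' \<and> foba_pot Q st' \<le> foba_pot Q st \<and>
    (st' = st \<or> card (fst st') < card (fst st))"
  using assms
proof (induction rule: rtranclp_induct)
  case (step y z)
  then show ?case
    using foba_inv_backward[of Q y z] foba_pot_backward[of Q y z] backward_card[of Q y z]
    by fastforce
qed simp

lemma foba_iter_step:
  fixes Q :: "real^'n \<Rightarrow> real"
  assumes "\<And>x. lb \<le> Q x" "foba_inv Q st" "foba_iter Q \<delta> st st'"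
  shows "foba_inv Q st'" "foba_pot Q st' \<le> foba_pot Q st - \<delta> / 2"
proof -
  obtain st1 where st1: "fwd Q st st1" "(bwd Q)\<^sup>*\<^sup>* st1 st'" "\<not> obj_stop Q \<delta> st"
    using assms(3) unfolding foba_iter_def by blast
  from backward_rtranclp[OF st1(2) foba_inv_forward[OF assms(2) st1(1)]]
    foba_pot_forward[OF assms(1,2) st1(1,3)]
  show "foba_inv Q st'" "foba_pot Q st' \<le> foba_pot Q st - \<delta> / 2" by auto
qed

lemma foba_no_infinite_run:
  fixes Q :: "real^'n \<Rightarrow> real"
  assumes lb: "\<And>x. lb \<le> Q x" and \<delta>: "0 < \<delta>"
    and f: "f 0 = foba_init" "\<And>n. foba_iter Q \<delta> (f n) (f (Suc n))"
  shows False
proof -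
  have inv: "foba_inv Q (f n)" for n
  proof (induction n)
    case 0
    show ?case using foba_inv_init f(1) by simp
  next
    case (Suc n)
    show ?case by (rule foba_iter_step(1)[OF lb Suc f(2)])
  qed
  have pot: "foba_pot Q (f n) \<le> foba_pot Q (f 0) - real n * (\<delta> / 2)" for n
  proof (induction n)
    case (Suc n)
    then show ?case using foba_iter_step(2)[OF lb inv f(2), of n] by (simp add: algebra_simps add_divide_distrib)
  qed simp
  have low: "lb \<le> foba_pot Q (f n)" for n
  proof -
    obtain F b D where st: "f n = (F, b, D)" by (rule prod_cases3)
    have "0 \<le> (\<Sum>j=1..card F. D j / 2)"
      using inv[of n] unfolding st foba_inv_def by (intro sum_nonneg) auto
    then show ?thesis using lb[of b] unfolding st foba_pot_def by simp
  qed
  obtain n where "foba_pot Q (f 0) - lb < real n * (\<delta> / 2)"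
    using reals_Archimedean3[of "\<delta> / 2"] \<delta> by (meson half_gt_zero)
  then show False using pot[of n] low[of n] by linarith
qed

section \<open>Existence of a next iteration\<close>

lemma ex_argmin_on:
  fixes g :: "'a \<Rightarrow> real"
  assumes "finite A" "A \<noteq> {}"
  shows "\<exists>i\<in>A. \<forall>j\<in>A. g i \<le> g j"
  using arg_min_if_finite(1)[OF assms, of g] arg_min_least[OF assms, of _ g]
  by (intro bexI[of _ "arg_min_on g A"]) auto

text \<open>Every backward step removes a coordinate, so the support size is a termination
  measure.\<close>

lemma backward_terminates:
  fixes Q :: "real^'n \<Rightarrow> real"
  assumes "\<And>F. \<exists>b. restr_min Q F b"
  shows "\<exists>st'. (bwd Q)\<^sup>*\<^sup>* st st' \<and> \<not> bwd_cont Q st'"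
proof (induction "card (fst st)" arbitrary: st rule: less_induct)
  case less
  show ?case
  proof (cases "bwd_cont Q st")
    case True
    obtain F b D where st: "st = (F, b, D)" by (rule prod_cases3)
    have "F \<noteq> {}" using True unfolding st bwd_cont_def by simp
    then obtain j where "j \<in> F" "\<forall>i\<in>F. Q (zero_at b j) \<le> Q (zero_at b i)"
      using ex_argmin_on[of F "\<lambda>i. Q (zero_at b i)"] by auto
    moreover obtain b' where "restr_min Q (F - {j}) b'" using assms by blast
    ultimately have step: "bwd Q st (F - {j}, b', D)"
      using True unfolding st bwd_def by auto
    from less[of "(F - {j}, b', D)"] backward_card[OF step]
    obtain st' where "(bwd Q)\<^sup>*\<^sup>* (F - {j}, b', D) st'" "\<not> bwd_cont Q st'" by auto
    with step show ?thesis by (meson converse_rtranclp_into_rtranclp)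
  qed blast
qed

text \<open>The stopping test succeeds for \<open>F = UNIV\<close>, so when it fails there are
  coordinates left outside \<open>F\<close>, and a best one exists among these finitely
  many.\<close>

lemma foba_progress:
  fixes Q :: "real^'n \<Rightarrow> real"
  assumes ex: "\<And>F. \<exists>b. restr_min Q F b" and stop: "\<not> obj_stop Q \<delta> st"
  shows "\<exists>st'. foba_iter Q \<delta> st st'"
proof -
  obtain F b D where st: "st = (F, b, D)" by (rule prod_cases3)
  have "- F \<noteq> {}" using stop unfolding st obj_stop_def by auto
  then obtain i where i: "i \<notin> F" "\<forall>i'. i' \<notin> F \<longrightarrow> line_min Q b i \<le> line_min Q b i'"
    using ex_argmin_on[of "- F" "line_min Q b"] by auto
  obtain b' where "restr_min Q (insert i F) b'" using ex by blast
  then have "fwd Q st (insert i F, b', D(card (insert i F) := Q b - Q b'))"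
    using i unfolding st fwd_def by auto
  then show ?thesis
    using stop backward_terminates[OF ex] unfolding foba_iter_def by meson
qed

section \<open>The bound on the support size, and the three claims together\<close>

theorem theorem1:
  fixes Q :: "real^'n \<Rightarrow> real" and grad :: "real^'n \<Rightarrow> real^'n"
    and rm rp :: "nat \<Rightarrow> real" and s :: nat and \<delta> :: real and \<beta>bar :: "real^'n"
  assumes convex: "convex_on UNIV Q"
    and deriv: "\<And>x. (Q has_derivative (\<lambda>h. grad x \<bullet> h)) (at x)"
    and cont_grad: "continuous_on UNIV grad"
    and hat_exists: "\<And>F. \<exists>b. restr_min Q F b"
    and rsc_s: "rsc Q grad s (rm s) (rp s)"
    and rsc_1: "rsc Q grad 1 (rm 1) (rp 1)"
    and s_pos: "s > 0"
    and \<beta>bar_opt: "\<And>b. l0norm b \<le> l0norm \<beta>bar \<Longrightarrow> Q \<beta>bar \<le> Q b"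
    and s_cond: "real s - real (l0norm \<beta>bar) >
        (real (l0norm \<beta>bar) + 1) * ((sqrt (rp s / rm s) + 1) * (2 * rp 1 / rm s))\<^sup>2"
    and \<delta>_cond: "\<delta> > 4 * rp 1 / (rm s)\<^sup>2 * (linf (grad \<beta>bar))\<^sup>2"
  shows "(\<nexists>f. f 0 = foba_init \<and> (\<forall>n. foba_iter Q \<delta> (f n) (f (Suc n))))
    \<and> (\<forall>st. (foba_iter Q \<delta>)\<^sup>*\<^sup>* foba_init st \<longrightarrow> \<not> obj_stop Q \<delta> st \<longrightarrow>
            (\<exists>st'. foba_iter Q \<delta> st st'))
    \<and> (\<forall>st. (foba_iter Q \<delta>)\<^sup>*\<^sup>* foba_init st \<longrightarrow> obj_stop Q \<delta> st \<longrightarrow>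
            card (fst st) \<le> s - l0norm \<beta>bar)"
proof -
  let ?k = "l0norm \<beta>bar" and ?G = "supp \<beta>bar"
  define m where "m = rm s"
  define p where "p = rp 1"
  define K where "K = sqrt (rp s / rm s) + 1"
  note r = rsc_s[folded m_def] and r1 = rsc_1[folded p_def]
  have s1: "1 \<le> s" using s_pos by simp
  have m: "0 < m" and p: "0 < p" using rsc_pos[OF r] rsc_pos[OF r1] by auto
  \<comment> \<open>These comparisons give \<open>K \<ge> 2\<close> and, further down,
    \<open>M \<ge> 16\<close>.\<close>
  have mp: "m \<le> p" using rsc_constants_le[OF r r1 s1] by simp
  have "m \<le> rp s" using rsc_constants_le[OF r r s1 s1] .
  then have "1 \<le> sqrt (rp s / rm s)" using m unfolding m_def by simp
  then have K: "2 \<le> K" unfolding K_def by simp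
  \<comment> \<open>A minimiser with unrestricted support bounds \<open>Q\<close> from below
    everywhere.\<close>
  obtain bmin where "restr_min Q UNIV bmin" using hat_exists by blast
  then have lb: "Q bmin \<le> Q x" for x by (rule restr_min_le) simp
  have \<delta>0: "0 < \<delta>"
    using \<delta>_cond p by (smt (verit) divide_nonneg_nonneg mult_nonneg_nonneg p_def zero_le_power2)
  \<comment> \<open>Every vector supported in \<open>?G\<close> is sparse enough to compete with
    \<open>\<beta>bar\<close>.\<close>
  have minbar: "restr_min Q ?G \<beta>bar"
    unfolding restr_min_def using \<beta>bar_opt l0norm_le_card[of _ ?G]
    by (auto simp: l0norm_def[of \<beta>bar])
  have size: "(real ?k + 1) * (K * (2 * p / m))\<^sup>2 < real s - real ?k"
    using s_cond unfolding K_def p_def m_def .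
  then have ks: "?k < s"
    by (smt (verit) of_nat_0_le_iff mult_nonneg_nonneg of_nat_less_iff zero_le_power2)

  have no_reach: False
    if inv: "foba_inv Q (F, b, D)" and stop: "\<not> obj_stop Q \<delta> (F, b, D)"
      and fw: "fwd Q (F, b, D) (F', b', D')" and ex: "\<not> bwd_cont Q (F', b', D')"
      and card: "card F' = s - ?k" for F b D F' b' D'
  proof -
    have min: "restr_min Q F b" using inv unfolding foba_inv_def by simp
    obtain i where i: "\<And>i'. i' \<notin> F \<Longrightarrow> line_min Q b i \<le> line_min Q b i'"
      and F': "F' = insert i F" and min': "restr_min Q F' b'"
      and D': "D' = D(card F' := Q b - Q b')"
      using fw unfolding fwd_def by auto
    define d where "d = Q b - Q b'"
    have d\<delta>: "\<delta> \<le> d" using forward_gain_ge[OF lb min fw stop] unfolding d_def .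
    then have d0: "0 < d" using \<delta>0 by simp
    have sb: "supp b \<subseteq> F" and sb': "supp b' \<subseteq> F'"
      using min min' unfolding restr_min_def by auto
    have cG: "card ?G = ?k" by (simp add: l0norm_def)
    \<comment> \<open>Size \<open>s - ?k\<close> is critical because \<open>?H\<close> still has at
      most \<open>s\<close> elements, so the constants at sparsity \<open>s\<close> apply to all
      differences supported in it.\<close>
    let ?H = "F' \<union> ?G"
    have H: "card ?H \<le> s" using card_Un_le[of F' ?G] card ks cG by simp
    obtain u where u: "restr_min Q ?H u" using hat_exists by blast
    have su: "supp u \<subseteq> ?H" using u unfolding restr_min_def by simp
    define N where "N = norm (b' - u)"
    have bx: "real (card (F' - ?G)) * d \<le> p * (norm (b' - \<beta>bar))\<^sup>2"
      using backward_exit_bound[OF r1 min' ex, of \<beta>bar ?G] unfolding D' d_def by simp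
    have "Q \<beta>bar \<le> Q b'"
      using \<delta>_cond d\<delta> by (intro sparse_minimum_le[OF r s1 p minbar sb' H _ bx])
        (simp add: p_def m_def)
    then have "norm (b' - \<beta>bar) \<le> K * N"
      using norm_diff_le_via_minimum[OF rsc_s s1 H u _ _] sb' unfolding K_def N_def by auto
    then have "(norm (b' - \<beta>bar))\<^sup>2 \<le> (K * N)\<^sup>2" by (intro power_mono) auto
    then have A: "real (card (F' - ?G)) * d \<le> p * (K * N)\<^sup>2"
      using bx p by (smt (verit) mult_left_mono)

    have "m / p * (Q b - Q u) \<le> real (card (?H - F)) * d"
    proof (rule greedy_gain[OF r r1 s1 min su _ H])
      show "F \<subseteq> ?H" using F' by auto
      fix j c assume "j \<in> ?H - F"
      then show "Q b - Q (b + c *\<^sub>R axis j 1) \<le> d"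
        using forward_le_line(2)[OF lb sb i min'[unfolded F'], of j c] unfolding d_def by simp
    qed
    also have "\<dots> \<le> (real ?k + 1) * d"
    proof (rule mult_right_mono)
      \<comment> \<open>Outside \<open>F\<close>, the set \<open>?H\<close> contains only
        \<open>i\<close> and coordinates of \<open>?G\<close>; this is the source of the factor
        \<open>?k + 1\<close>.\<close>
      have "card (?H - F) \<le> card (insert i ?G)" using F' by (intro card_mono) auto
      also have "\<dots> \<le> Suc ?k" using cG card_insert_le_m1[of "Suc ?k" ?G i] by simp
      finally show "real (card (?H - F)) \<le> real ?k + 1" by simp
    qed (use d0 in simp)
    finally have g: "m / p * (Q b - Q u) \<le> (real ?k + 1) * d" .
    have "l0norm (b' - u) \<le> s"
      using l0norm_le_card[of "b' - u" ?H] supp_diff_subset[of b' u] su sb' H by fastforce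
    from rsc_lower[OF r this]
    have "m / 2 * N\<^sup>2 \<le> Q b' - Q u - grad u \<bullet> (b' - u)" unfolding N_def .
    moreover have "grad u \<bullet> (b' - u) = 0"
      using inner_grad_diff[OF restr_min_grad_zero[OF r s1 u] su, of b' ?H] sb' by auto
    \<comment> \<open>Replacing \<open>Q b'\<close> by the larger \<open>Q b\<close> matches the
      left side of \<open>g\<close>.\<close>
    ultimately have "m / 2 * N\<^sup>2 \<le> Q b - Q u" using d0 unfolding d_def by linarith
    then have "m / p * (m / 2 * N\<^sup>2) \<le> (real ?k + 1) * d"
      using g m p by (smt (verit) divide_nonneg_nonneg mult_left_mono)
    then have N: "m\<^sup>2 * N\<^sup>2 \<le> 2 * p * ((real ?k + 1) * d)"
      using p by (simp add: field_simps power2_eq_square)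

    \<comment> \<open>\<open>M\<close> is the squared bracket in the assumption on \<open>s\<close>;
      combining \<open>A\<close> with \<open>N\<close> uses up only half of it.\<close>
    define M where "M = (K * (2 * p / m))\<^sup>2"
    have "m\<^sup>2 * (real (card (F' - ?G)) * d) \<le> p * K\<^sup>2 * (m\<^sup>2 * N\<^sup>2)"
      using mult_left_mono[OF A, of "m\<^sup>2"] by (simp add: power_mult_distrib mult_ac)
    also have "\<dots> \<le> p * K\<^sup>2 * (2 * p * ((real ?k + 1) * d))"
      using N p by (intro mult_left_mono) auto
    also have "\<dots> = m\<^sup>2 * ((real ?k + 1) * (M / 2) * d)"
      unfolding M_def using m by (simp add: field_simps power2_eq_square)
    finally have "m\<^sup>2 * (real (card (F' - ?G)) * d) \<le> m\<^sup>2 * ((real ?k + 1) * (M / 2) * d)" .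
    then have c: "real (card (F' - ?G)) \<le> (real ?k + 1) * (M / 2)"
      using m d0 by simp
    \<comment> \<open>By \<open>M \<ge> 16\<close> the other half of \<open>(?k + 1) * M\<close>
      exceeds \<open>?k\<close>, which pays for the at most \<open>?k\<close> coordinates of
      \<open>F'\<close> inside \<open>?G\<close>.\<close>
    have "2 \<le> 2 * p / m" using m mp by (simp add: field_simps)
    then have "2 * 2 \<le> K * (2 * p / m)" using K by (intro mult_mono) auto
    then have "(2 * 2)\<^sup>2 \<le> M" unfolding M_def by (intro power_mono) auto
    then have "(real ?k + 1) * 1 \<le> (real ?k + 1) * (M / 2)" by (intro mult_left_mono) auto
    moreover have "real s - real ?k \<le> real (card (F' - ?G)) + real ?k"
      using card ks cG diff_card_le_card_Diff[of ?G F'] by simp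
    ultimately have "real s - real ?k \<le> (real ?k + 1) * M" using c by (simp add: field_simps)
    then show False using size unfolding M_def by linarith
  qed

  \<comment> \<open>The bound is strict so that a forward step, adding one coordinate, leaves only
    the size exactly \<open>s - ?k\<close> to be excluded.\<close>
  have reach: "foba_inv Q st \<and> card (fst st) < s - ?k"
    if "(foba_iter Q \<delta>)\<^sup>*\<^sup>* foba_init st" for st
    using that
  proof (induction rule: rtranclp_induct)
    case base
    then show ?case using foba_inv_init ks by (simp add: foba_init_def)
  next
    case (step y z)
    obtain st1 where st1: "fwd Q y st1" "(bwd Q)\<^sup>*\<^sup>* st1 z" "\<not> obj_stop Q \<delta> y"
      "\<not> bwd_cont Q z"
      using step.hyps(2) unfolding foba_iter_def by blast
    obtain F b D F1 b1 D1 where y: "y = (F, b, D)" "st1 = (F1, b1, D1)"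
      by (cases y, cases st1) auto
    have c: "card F1 = Suc (card F)" using card_forward st1(1) unfolding y by metis
    have inv1: "foba_inv Q st1" using foba_inv_forward step.IH st1(1) by blast
    have "card (fst z) < s - ?k"
    \<comment> \<open>Without backward steps \<open>no_reach\<close> applies; otherwise the support
      has shrunk below \<open>card F1 \<le> s - ?k\<close>.\<close>
    proof (cases "z = st1")
      case True
      then have "card F1 \<noteq> s - ?k"
        using no_reach[of F b D F1 b1 D1] step.IH st1 unfolding y by blast
      then show ?thesis using step.IH c True unfolding y by simp
    next
      case False
      then show ?thesis
        using backward_rtranclp[OF st1(2) inv1] step.IH c unfolding y by simp
    qed
    then show ?case using backward_rtranclp[OF st1(2) inv1] by simp
  qed

  show ?thesis
  proof (intro conjI allI impI notI)
    assume "\<exists>f. f 0 = foba_init \<and> (\<forall>n. foba_iter Q \<delta> (f n) (f (Suc n)))"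
    then obtain f where "f 0 = foba_init" "\<And>n. foba_iter Q \<delta> (f n) (f (Suc n))" by blast
    then show False by (rule foba_no_infinite_run[OF lb \<delta>0])
  next
    fix st assume "\<not> obj_stop Q \<delta> st"
    then show "\<exists>st'. foba_iter Q \<delta> st st'" by (rule foba_progress[OF hat_exists])
  next
    fix st assume "(foba_iter Q \<delta>)\<^sup>*\<^sup>* foba_init st"
    then show "card (fst st) \<le> s - ?k" using reach by (simp add: less_imp_le)
  qed
qed

end
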